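(* Let $n,k$ be positive integers and let $g(x)\in\mathbb{F}_2[x]$ be a polynomial of degree $m>1$ that divides $x^n-1$ (hence also divides $x^{kn}-1$). Let $\mathcal{C}_n$ and $\mathcal{C}_{kn}$ be the binary cyclic codes of lengths $n$ and $kn$, respectively, both having generator polynomial $g(x)$. Then the full automorphism group $\mathrm{Aut}\,\mathcal{C}_{kn}$ contains a subgroup that is isomorphic to $(\mathrm{S}_k)^n : G$, where $G\cong \mathrm{Aut}\,\mathcal{C}_n$ is the full automorphism group of $\mathcal{C}_n$.
   Context: All polynomials are over $\mathbb{F}_2$. For $h(x)\in\mathbb{F}_2[x]$ dividing $x^N-1$, the binary cyclic code of length $N$ with generator polynomial $h$ is the set of all $(c_0,\dots,c_{N-1})\in\mathbb{F}_2^N$ such that $c_0+c_1x+\cdots+c_{N-1}x^{N-1}$ lies in the ideal generated by $h$ in $\mathbb{F}_2[x]/(x^N-1)$. For a code $\mathcal{C}$ of length $N$, an automorphism of $\mathcal{C}$ is a permutation of the $N$ coordinate positions that maps each codeword of $\mathcal{C}$ to a codeword of $\mathcal{C}$; the full automorphism group $\mathrm{Aut}\,\mathcal{C}\leqslant \mathrm{S}_N$ is the group of all of these under composition. $\mathrm{S}_k$ is the symmetric group of degree $k$, $(\mathrm{S}_k)^n$ is the direct product of $n$ copies of it, and $A:B$ denotes a semidirect product (split extension) with normal subgroup $A$ and complement $B$. *)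

theory Defs
  imports
    "HOL-Library.Z2"
    "HOL-Algebra.Algebraic_Closure_Type"
    "HOL-Algebra.Product_Groups"
    "HOL-Algebra.Sym_Groups"
    "HOL-Combinatorics.Permutations"
    "HOL-Computational_Algebra.Polynomial"
begin

text \<open>
  The field with two elements is \<^typ>\<open>bit\<close>. A word $(c_0,\dots,c_{N-1})$ is the list
  \<open>[c\<^sub>0, \<dots>, c\<^sub>N\<^sub>-\<^sub>1]\<close>, so \<open>Poly c\<close> is $c_0 + c_1 x + \cdots + c_{N-1} x^{N-1}$ and the
  coordinate positions are \<open>{..<N}\<close>.
\<close>

abbreviation F2x :: "bit poly ring"
  where "F2x \<equiv> ring_of_type_algebra"

definition cyclic_ideal :: "nat \<Rightarrow> bit poly set"
  where "cyclic_ideal N = Idl\<^bsub>F2x\<^esub> {Polynomial.monom 1 N - 1}"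

definition cyclic_ring :: "nat \<Rightarrow> bit poly set ring"
  where "cyclic_ring N = F2x Quot cyclic_ideal N"

definition residue_class :: "nat \<Rightarrow> bit poly \<Rightarrow> bit poly set"
  where "residue_class N p = cyclic_ideal N +>\<^bsub>F2x\<^esub> p"

definition cyclic_code :: "nat \<Rightarrow> bit poly \<Rightarrow> bit list set"
  where "cyclic_code N h =
    {c. length c = N \<and> residue_class N (Poly c) \<in> Idl\<^bsub>cyclic_ring N\<^esub> {residue_class N h}}"

text \<open>
  \<^const>\<open>permute_list\<close> puts entry \<open>p i\<close> at position \<open>i\<close>, whereas moving entry \<open>i\<close> to position
  \<open>p i\<close> is \<open>permute_list (inv p)\<close>. The permutations preserving a given code are the same for both
  conventions, since there are only finitely many of them and so they are closed under inverses.
\<close>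

definition code_automorphism :: "nat \<Rightarrow> bit list set \<Rightarrow> (nat \<Rightarrow> nat) \<Rightarrow> bool"
  where "code_automorphism N C p \<longleftrightarrow> p permutes {..<N} \<and> (\<forall>c\<in>C. permute_list p c \<in> C)"

definition Aut_code :: "nat \<Rightarrow> bit list set \<Rightarrow> (nat \<Rightarrow> nat) monoid"
  where "Aut_code N C = \<lparr>carrier = {p. code_automorphism N C p}, monoid.mult = (\<circ>), one = id\<rparr>"

text \<open>
  \<open>is_semidirect_product G A B\<close> says that \<open>G\<close> is of the form $A : B$, where \<open>A\<close> and \<open>B\<close> are
  given up to isomorphism. As in that notation, the action of \<open>B\<close> on \<open>A\<close> is not specified.
\<close>

definition is_semidirect_product ::
    "('a, 'x) monoid_scheme \<Rightarrow> ('b, 'y) monoid_scheme \<Rightarrow> ('c, 'z) monoid_scheme \<Rightarrow> bool"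
  where "is_semidirect_product G A B \<longleftrightarrow>
    (\<exists>N K. N \<lhd> G \<and> subgroup K G \<and> N \<inter> K = {\<one>\<^bsub>G\<^esub>} \<and> N <#>\<^bsub>G\<^esub> K = carrier G \<and>
      G\<lparr>carrier := N\<rparr> \<cong> A \<and> G\<lparr>carrier := K\<rparr> \<cong> B)"

end

theory Submission
  imports Defs
begin

text \<open>
  As $g$ divides $x^n - 1$, reducing exponents modulo $n$ does not affect divisibility by $g$. So a
  word of length $kn$ lies in $\mathcal{C}_{kn}$ iff its folding, which adds up the entries in each
  residue class modulo $n$, lies in $\mathcal{C}_n$. A permutation of the $kn$ positions that
  induces an automorphism of $\mathcal{C}_n$ on the residue classes is therefore an automorphism of
  $\mathcal{C}_{kn}$. Mapping such a permutation to the induced one is a homomorphism onto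
  $\mathrm{Aut}\,\mathcal{C}_n$. It is split by letting an automorphism act on each of the $k$ blocks
  of $n$ consecutive positions, and its kernel permutes each of the $n$ residue classes separately.
\<close>

section \<open>Cyclic codes and folding\<close>

text \<open>In the quotient ring the ideal generated by the class of \<open>g\<close> consists of
  the classes of multiples of \<open>g\<close>. As \<open>g\<close> divides x^N - 1, divisibility by
  \<open>g\<close> is the same for all representatives of a class. From here on codes are handled by
  divisibility in F_2[x] alone.\<close>

lemma cyclic_code_iff_dvd:
  assumes "g dvd Polynomial.monom 1 N - 1"
  shows "c \<in> cyclic_code N g \<longleftrightarrow> length c = N \<and> g dvd Poly c"
proof -
  interpret F: cring F2x
    by (rule cring_from_type_algebra)
  define w :: "bit poly" where "w = Polynomial.monom 1 N - 1"
  have car: "carrier F2x = UNIV" and mult: "x \<otimes>\<^bsub>F2x\<^esub> y = x * y"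
    and add: "x \<oplus>\<^bsub>F2x\<^esub> y = x + y" for x y
    by (simp_all add: ring_of_type_algebra_def)
  have I: "cyclic_ideal N = {r * w | r. True}"
    unfolding cyclic_ideal_def w_def[symmetric]
    by (subst F.cgenideal_eq_genideal[symmetric]) (simp_all add: cgenideal_def car mult)
  interpret I: ideal "cyclic_ideal N" F2x
    unfolding cyclic_ideal_def by (rule F.genideal_ideal) (simp add: car)
  interpret Q: cring "cyclic_ring N"
    unfolding cyclic_ring_def by (rule I.quotient_is_cring) (rule F.is_cring)
  have Qcar: "carrier (cyclic_ring N) = range (residue_class N)"
    by (auto simp: cyclic_ring_def FactRing_def A_RCOSETS_def' car residue_class_def)
  have Qmult: "residue_class N a \<otimes>\<^bsub>cyclic_ring N\<^esub> residue_class N b = residue_class N (a * b)" for a b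
    by (simp add: cyclic_ring_def FactRing_def residue_class_def I.rcoset_mult_add car mult)
  have coset: "residue_class N p = {r * w + p | r. True}" for p
    by (auto simp: residue_class_def a_r_coset_def' I add)
  have eq: "residue_class N a = residue_class N b \<longleftrightarrow> w dvd a - b" for a b
  proof
    assume eq: "residue_class N a = residue_class N b"
    have "0 * w + a \<in> residue_class N a"
      unfolding coset by blast
    then obtain r where "a = r * w + b"
      unfolding eq unfolding coset by auto
    then show "w dvd a - b" by simp
  next
    assume "w dvd a - b"
    then obtain r where r: "a - b = w * r" by (elim dvdE)
    have "x * w + a = (x + r) * w + b" "x * w + b = (x - r) * w + a" for x
      using r by (simp_all add: algebra_simps)
    then show "residue_class N a = residue_class N b"
      unfolding coset by blast
  qed
  have gen: "Idl\<^bsub>cyclic_ring N\<^esub> {residue_class N g} = {residue_class N (r * g) | r. True}"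
  proof -
    have "PIdl\<^bsub>cyclic_ring N\<^esub> residue_class N g = {residue_class N r \<otimes>\<^bsub>cyclic_ring N\<^esub> residue_class N g | r. True}"
      unfolding cgenideal_def Qcar by blast
    then show ?thesis
      by (subst Q.cgenideal_eq_genideal[symmetric]) (simp_all add: Qcar Qmult)
  qed
  have "residue_class N p \<in> Idl\<^bsub>cyclic_ring N\<^esub> {residue_class N g} \<longleftrightarrow> g dvd p" for p
  proof
    assume "residue_class N p \<in> Idl\<^bsub>cyclic_ring N\<^esub> {residue_class N g}"
    then obtain r where "w dvd p - r * g"
      unfolding gen by (auto simp: eq)
    \<comment> \<open>The hypothesis on \<open>g\<close> enters here; in general the generated ideal
      only sees the gcd of \<open>g\<close> and x^N - 1.\<close>
    then have "g dvd p - r * g"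
      using assms dvd_trans unfolding w_def by blast
    then show "g dvd p"
      by (metis diff_add_cancel dvd_add dvd_triv_right)
  next
    assume "g dvd p"
    then show "residue_class N p \<in> Idl\<^bsub>cyclic_ring N\<^esub> {residue_class N g}"
      unfolding gen by (auto elim!: dvdE simp: mult.commute)
  qed
  then show ?thesis
    by (simp add: cyclic_code_def)
qed

section \<open>Reduction modulo x^n - 1 as folding of words\<close>

lemma monom_1_minus_1_dvd:
  "(Polynomial.monom 1 n - 1 :: 'a::comm_ring_1 poly) dvd Polynomial.monom 1 (k * n) - 1"
proof -
  have "Polynomial.monom 1 (k * n) = (Polynomial.monom 1 n :: 'a poly) ^ k"
    by (simp add: monom_power mult.commute)
  then show ?thesis
    by (simp add: power_diff_1_eq)
qed

text \<open>For \<open>n > 0\<close> these are the coefficients of the remainder of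
  \<open>Poly c\<close> on division by x^n - 1, padded with zeros to length
  \<open>n\<close>.\<close>

definition fold_word :: "nat \<Rightarrow> 'a::comm_monoid_add list \<Rightarrow> 'a list"
  where "fold_word n c = map (\<lambda>j. \<Sum>i | i < length c \<and> i mod n = j. c ! i) [0..<n]"

lemma length_fold_word [simp]: "length (fold_word n c) = n"
  by (simp add: fold_word_def)

lemma nth_fold_word:
  "j < n \<Longrightarrow> fold_word n c ! j = (\<Sum>i | i < length c \<and> i mod n = j. c ! i)"
  by (simp add: fold_word_def)

lemma Poly_eq_sum_monom: "Poly c = (\<Sum>i<length c. Polynomial.monom (c ! i) i)"
  by (induction c rule: rev_induct) (simp_all add: Poly_snoc nth_append)

lemma monom_sum: "Polynomial.monom (\<Sum>i\<in>A. f i) j = (\<Sum>i\<in>A. Polynomial.monom (f i) j)"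
  by (induction A rule: infinite_finite_induct) (simp_all flip: add_monom)

text \<open>Modulo x^n - 1, and so modulo \<open>g\<close>, the monomial x^i is congruent to x^(i
  mod n). Hence the two polynomials differ by a multiple of \<open>g\<close>.\<close>

lemma dvd_Poly_fold_word_iff:
  fixes g :: "'a::comm_ring_1 poly"
  assumes "n > 0" and g: "g dvd Polynomial.monom 1 n - 1"
  shows "g dvd Poly (fold_word n c) \<longleftrightarrow> g dvd Poly c"
proof -
  have "Poly (fold_word n c) =
    (\<Sum>j<n. \<Sum>i | i < length c \<and> i mod n = j. Polynomial.monom (c ! i) (i mod n))"
    by (auto simp: Poly_eq_sum_monom nth_fold_word monom_sum intro!: sum.cong)
  also have "\<dots> = (\<Sum>j<n. \<Sum>i\<in>{i \<in> {..<length c}. i mod n = j}. Polynomial.monom (c ! i) (i mod n))"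
    by simp
  also have "\<dots> = (\<Sum>i<length c. Polynomial.monom (c ! i) (i mod n))"
    using \<open>n > 0\<close> by (intro sum.group) auto
  finally have fold: "Poly (fold_word n c) = \<dots>" .
  have step: "g dvd Polynomial.monom a i - Polynomial.monom a (i mod n)" for a i
  proof -
    have "Polynomial.monom a i = Polynomial.monom a (i mod n) * Polynomial.monom 1 (i div n * n)"
      by (simp add: mult_monom)
    then have "Polynomial.monom a i - Polynomial.monom a (i mod n) =
        Polynomial.monom a (i mod n) * (Polynomial.monom 1 (i div n * n) - 1)"
      by (simp add: algebra_simps)
    then show ?thesis
      using g monom_1_minus_1_dvd dvd_trans dvd_mult by metis
  qed
  have "g dvd Poly c - Poly (fold_word n c)"
    unfolding fold Poly_eq_sum_monom[of c] by (simp flip: sum_subtractf add: dvd_sum step)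
  then show ?thesis
    by (metis diff_add_cancel dvd_add_right_iff)
qed

text \<open>Reduction modulo \<open>n\<close> intertwines \<open>q\<close> with \<open>p\<close>.
  This is a relation because a general \<open>q\<close> does not respect residue classes and then
  covers no \<open>p\<close>.\<close>

definition covers :: "nat \<Rightarrow> nat \<Rightarrow> (nat \<Rightarrow> nat) \<Rightarrow> (nat \<Rightarrow> nat) \<Rightarrow> bool"
  where "covers n N q p \<longleftrightarrow> (\<forall>i<N. q i mod n = p (i mod n))"

lemma covers_id [simp]: "covers n N id id"
  by (simp add: covers_def)

lemma covers_comp:
  assumes "q' permutes {..<N}" "covers n N q p" "covers n N q' p'"
  shows "covers n N (q \<circ> q') (p \<circ> p')"
  using assms permutes_in_image[OF assms(1)] by (simp add: covers_def)

lemma covers_inv: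
  assumes q: "q permutes {..<N}" and p: "p permutes S" and "covers n N q p"
  shows "covers n N (inv_into UNIV q) (inv_into UNIV p)"
  unfolding covers_def
proof (intro allI impI)
  fix i assume "i < N"
  then have "inv_into UNIV q i < N"
    using permutes_in_image[OF permutes_inv[OF q]] by auto
  with assms(3) have "q (inv_into UNIV q i) mod n = p (inv_into UNIV q i mod n)"
    by (simp add: covers_def)
  then have "i mod n = p (inv_into UNIV q i mod n)"
    by (simp add: permutes_inverses[OF q])
  then show "inv_into UNIV q i mod n = inv_into UNIV p (i mod n)"
    by (simp add: permutes_inverses[OF p])
qed

text \<open>Since \<open>q\<close> maps the residue class of \<open>j\<close> bijectively onto that
  of \<open>p j\<close>, both sides add up the same entries of \<open>c\<close> at position
  \<open>j\<close>.\<close>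

lemma fold_word_permute_list:
  assumes "n > 0" and p: "p permutes {..<n}" and q: "q permutes {..<length c}"
    and cov: "covers n (length c) q p"
  shows "fold_word n (permute_list q c) = permute_list p (fold_word n c)"
proof (rule nth_equalityI)
  fix j assume "j < length (fold_word n (permute_list q c))"
  then have j: "j < n" by simp
  then have pj: "p j < n"
    using permutes_in_image[OF p] by auto
  have "bij_betw q {i. i < length c \<and> i mod n = j} {i. i < length c \<and> i mod n = p j}"
    unfolding bij_betw_def
  proof
    show "inj_on q {i. i < length c \<and> i mod n = j}"
      using permutes_inj[OF q] by (rule inj_on_subset) simp
    show "q ` {i. i < length c \<and> i mod n = j} = {i. i < length c \<and> i mod n = p j}"
    proof (intro equalityI subsetI)
      fix i assume "i \<in> q ` {i. i < length c \<and> i mod n = j}"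
      then show "i \<in> {i. i < length c \<and> i mod n = p j}"
        using cov permutes_in_image[OF q] by (auto simp: covers_def)
    next
      fix i assume i: "i \<in> {i. i < length c \<and> i mod n = p j}"
      define i' where "i' = inv_into UNIV q i"
      have "i' < length c"
        using i permutes_in_image[OF permutes_inv[OF q]] by (auto simp: i'_def)
      moreover have "i' mod n = j"
        \<comment> \<open>The inverse of \<open>q\<close> covers the inverse of \<open>p\<close>, so
          it leads from the class of \<open>p j\<close> back to that of \<open>j\<close>.\<close>
        using covers_inv[OF q p cov] i permutes_inverses[OF p] by (auto simp: covers_def i'_def)
      moreover have "q i' = i"
        by (simp add: i'_def permutes_inverses[OF q])
      ultimately show "i \<in> q ` {i. i < length c \<and> i mod n = j}" by blast
    qed
  qed
  then have "(\<Sum>i | i < length c \<and> i mod n = j. c ! q i) = (\<Sum>i | i < length c \<and> i mod n = p j. c ! i)"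
    by (rule sum.reindex_bij_betw)
  then show "fold_word n (permute_list q c) ! j = permute_list p (fold_word n c) ! j"
    using j pj p q by (simp add: nth_fold_word permute_list_nth)
qed simp

lemma code_automorphism_covers:
  assumes "n > 0" and g: "g dvd Polynomial.monom 1 n - 1"
    and p: "code_automorphism n (cyclic_code n g) p"
    and q: "q permutes {..<k * n}" and cov: "covers n (k * n) q p"
  shows "code_automorphism (k * n) (cyclic_code (k * n) g) q"
  unfolding code_automorphism_def
proof (intro conjI ballI q)
  have gk: "g dvd Polynomial.monom 1 (k * n) - 1"
    using g monom_1_minus_1_dvd dvd_trans by blast
  note iff = cyclic_code_iff_dvd[OF gk] cyclic_code_iff_dvd[OF g]
  fix c assume "c \<in> cyclic_code (k * n) g"
  then have len: "length c = k * n" and "fold_word n c \<in> cyclic_code n g"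
    using dvd_Poly_fold_word_iff[OF \<open>n > 0\<close> g] by (simp_all add: iff)
  then have "permute_list p (fold_word n c) \<in> cyclic_code n g"
    using p by (simp add: code_automorphism_def)
  moreover have "permute_list p (fold_word n c) = fold_word n (permute_list q c)"
    using fold_word_permute_list[OF \<open>n > 0\<close>, of p q c] p q cov len by (simp add: code_automorphism_def)
  ultimately show "permute_list q c \<in> cyclic_code (k * n) g"
    using dvd_Poly_fold_word_iff[OF \<open>n > 0\<close> g] len by (simp add: iff)
qed

section \<open>The group structure\<close>

lemma permutes_group:
  assumes perm: "\<And>p. p \<in> P \<Longrightarrow> p permutes S" and id: "id \<in> P"
    and comp: "\<And>p q. p \<in> P \<Longrightarrow> q \<in> P \<Longrightarrow> p \<circ> q \<in> P"
    and inv: "\<And>p. p \<in> P \<Longrightarrow> inv_into UNIV p \<in> P"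
  shows "group \<lparr>carrier = P, monoid.mult = (\<circ>), one = id\<rparr>"
proof (rule groupI)
  fix p assume "p \<in> carrier \<lparr>carrier = P, monoid.mult = (\<circ>), one = id\<rparr>"
  then show "\<exists>q\<in>carrier \<lparr>carrier = P, monoid.mult = (\<circ>), one = id\<rparr>.
      q \<otimes>\<^bsub>\<lparr>carrier = P, monoid.mult = (\<circ>), one = id\<rparr>\<^esub> p
        = \<one>\<^bsub>\<lparr>carrier = P, monoid.mult = (\<circ>), one = id\<rparr>\<^esub>"
    by (intro bexI[of _ "inv_into UNIV p"]) (simp_all add: inv permutes_inv_o(2)[OF perm])
qed (auto simp: id comp comp_assoc)

text \<open>An automorphism is only required to map \<open>C\<close> into itself. As
  \<open>C\<close> is finite and permuting entries is injective, the map is onto \<open>C\<close>,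
  so its inverse preserves \<open>C\<close> too.\<close>

lemma code_automorphism_inv:
  assumes C: "C \<subseteq> {c. length c = N}" and p: "code_automorphism N C p"
  shows "code_automorphism N C (inv_into UNIV p)"
proof -
  have perm: "p permutes {..<N}" and closed: "permute_list p ` C \<subseteq> C"
    using p by (auto simp: code_automorphism_def)
  have undo: "permute_list (inv_into UNIV p) (permute_list p c) = c" if "c \<in> C" for c
  proof -
    have "inv_into UNIV p permutes {..<length c}"
      using that C permutes_inv[OF perm] by auto
    from permute_list_compose[OF this, of p] show ?thesis
      by (simp add: permutes_inv_o(1)[OF perm])
  qed
  have "set c \<subseteq> {0, 1}" for c :: "bit list"
    by auto
  then have "finite {c :: bit list. length c = N}"
    using finite_lists_length_eq[of "{0, 1} :: bit set" N] by simp
  then have "finite C"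
    using C finite_subset by blast
  moreover have "inj_on (permute_list p) C"
    using undo by (rule inj_on_inverseI)
  ultimately have "permute_list p ` C = C"
    using closed by (intro endo_inj_surj)
  then have "permute_list (inv_into UNIV p) c \<in> C" if "c \<in> C" for c
    using undo that by (metis imageE)
  then show ?thesis
    using permutes_inv[OF perm] by (simp add: code_automorphism_def)
qed

text \<open>Permuting lists is a right action: \<open>p \<circ> q\<close> acts by \<open>p\<close>
  first and then by \<open>q\<close>. Closure under composition is unaffected by this
  reversal.\<close>

lemma code_automorphism_comp:
  assumes C: "C \<subseteq> {c. length c = N}"
    and p: "code_automorphism N C p" and q: "code_automorphism N C q"
  shows "code_automorphism N C (p \<circ> q)"
  unfolding code_automorphism_def
proof (intro conjI ballI)
  show "p \<circ> q permutes {..<N}"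
    using p q by (auto simp: code_automorphism_def intro: permutes_compose)
  fix c assume "c \<in> C"
  then have "permute_list (p \<circ> q) c = permute_list q (permute_list p c)"
    using q C by (intro permute_list_compose) (auto simp: code_automorphism_def)
  then show "permute_list (p \<circ> q) c \<in> C"
    using p q \<open>c \<in> C\<close> by (auto simp: code_automorphism_def)
qed

lemma cyclic_code_length: "cyclic_code N g \<subseteq> {c. length c = N}"
  by (auto simp: cyclic_code_def)

lemma group_Aut_code:
  assumes "C \<subseteq> {c. length c = N}"
  shows "group (Aut_code N C)"
  unfolding Aut_code_def
proof (rule permutes_group)
  show "p permutes {..<N}" if "p \<in> {p. code_automorphism N C p}" for p
    using that by (simp add: code_automorphism_def)
  show "id \<in> {p. code_automorphism N C p}"
    by (simp add: code_automorphism_def permutes_id)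
qed (simp_all add: code_automorphism_comp[OF assms] code_automorphism_inv[OF assms])

text \<open>A homomorphism with a section \<open>s\<close> splits the group: its kernel is normal
  and the image of \<open>s\<close> is a complement.\<close>

lemma is_semidirect_product_if_split:
  assumes "group G" "group B" and pi: "\<pi> \<in> hom G B" and s: "s \<in> hom B G"
    and split: "\<And>b. b \<in> carrier B \<Longrightarrow> \<pi> (s b) = b"
    and ker: "G\<lparr>carrier := kernel G B \<pi>\<rparr> \<cong> A"
  shows "is_semidirect_product G A B"
proof -
  interpret pi: group_hom G B \<pi>
    using assms by (simp add: group_hom_def group_hom_axioms_def)
  interpret s: group_hom B G s
    using assms by (simp add: group_hom_def group_hom_axioms_def)
  have K: "subgroup (s ` carrier B) G"
    by (rule s.img_is_subgroup)
  have "kernel G B \<pi> \<inter> s ` carrier B = {\<one>\<^bsub>G\<^esub>}"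
  proof (intro equalityI subsetI)
    fix x assume "x \<in> kernel G B \<pi> \<inter> s ` carrier B"
    then obtain b where "b \<in> carrier B" "x = s b" "\<pi> (s b) = \<one>\<^bsub>B\<^esub>"
      by (auto simp: kernel_def)
    then show "x \<in> {\<one>\<^bsub>G\<^esub>}"
      using split s.hom_one by simp
  next
    fix x assume "x \<in> {\<one>\<^bsub>G\<^esub>}"
    then show "x \<in> kernel G B \<pi> \<inter> s ` carrier B"
      using subgroup.one_closed[OF K] by (simp add: kernel_def)
  qed
  moreover have "kernel G B \<pi> <#>\<^bsub>G\<^esub> s ` carrier B = carrier G"
  proof (intro equalityI subsetI)
    fix x assume "x \<in> kernel G B \<pi> <#>\<^bsub>G\<^esub> s ` carrier B"
    then show "x \<in> carrier G"
      by (auto simp: set_mult_def kernel_def)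
  next
    fix x assume x: "x \<in> carrier G"
    \<comment> \<open>The kernel component of \<open>x\<close>: both \<open>x\<close> and
      \<open>s (\<pi> x)\<close> have image \<open>\<pi> x\<close>, so the quotient is mapped to the
      identity.\<close>
    let ?y = "x \<otimes>\<^bsub>G\<^esub> inv\<^bsub>G\<^esub> s (\<pi> x)"
    have "?y \<in> kernel G B \<pi>"
      using x split by (simp add: kernel_def)
    moreover have "s (\<pi> x) \<in> s ` carrier B"
      using x by simp
    ultimately have "?y \<otimes>\<^bsub>G\<^esub> s (\<pi> x) \<in> kernel G B \<pi> <#>\<^bsub>G\<^esub> s ` carrier B"
      unfolding set_mult_def by blast
    moreover have "?y \<otimes>\<^bsub>G\<^esub> s (\<pi> x) = x"
      using x by (simp add: pi.G.m_assoc)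
    ultimately show "x \<in> kernel G B \<pi> <#>\<^bsub>G\<^esub> s ` carrier B"
      by simp
  qed
  moreover have "G\<lparr>carrier := s ` carrier B\<rparr> \<cong> B"
  proof (rule is_isoI)
    have "inj_on \<pi> (s ` carrier B)" "\<pi> ` s ` carrier B = carrier B"
      using split by (auto simp: inj_on_def image_image)
    then show "\<pi> \<in> iso (G\<lparr>carrier := s ` carrier B\<rparr>) B"
      using split by (auto simp: iso_def hom_def bij_betw_def)
  qed
  ultimately show ?thesis
    unfolding is_semidirect_product_def
    using pi.normal_kernel K ker by blast
qed

section \<open>Permutations preserving all residue classes\<close>

definition residue_perms :: "nat \<Rightarrow> nat \<Rightarrow> (nat \<Rightarrow> nat) set"
  where "residue_perms k n = {q. q permutes {..<k * n} \<and> covers n (k * n) q id}"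

text \<open>Positions are written as \<open>a * n + j\<close> with block number \<open>a\<close> and
  residue \<open>j\<close>. Together with \<open>block_cases\<close> and \<open>block_eq_iff\<close>
  this identifies positions with such pairs.\<close>

lemma block_less: "a < k \<Longrightarrow> j < n \<Longrightarrow> a * n + j < k * (n::nat)"
proof -
  assume "a < k" "j < n"
  then have "a * n + j < Suc a * n" by simp
  also have "\<dots> \<le> k * n" using \<open>a < k\<close> by (intro mult_le_mono1) simp
  finally show ?thesis .
qed

lemma permutes_if_inj:
  assumes "finite S" "inj_on p S" "p ` S \<subseteq> S" "\<And>x. x \<notin> S \<Longrightarrow> p x = x"
  shows "p permutes S"
  using assms by (intro bij_imp_permutes) (auto simp: bij_betw_def endo_inj_surj)

text \<open>The members of \<^term>\<open>sym_group k\<close> permute \<open>{1..k}\<close>, whereas block indices run from \<open>0\<close>.\<close>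

definition spread :: "nat \<Rightarrow> nat \<Rightarrow> (nat \<Rightarrow> nat \<Rightarrow> nat) \<Rightarrow> nat \<Rightarrow> nat"
  where "spread k n f i = (if i < k * n then (f (i mod n) (Suc (i div n)) - 1) * n + i mod n else i)"

lemma spread_block:
  "a < k \<Longrightarrow> j < n \<Longrightarrow> spread k n f (a * n + j) = (f j (Suc a) - 1) * n + j"
  using block_less[of a k j n] by (simp add: spread_def)

lemma block_cases:
  assumes "i < k * (n::nat)"
  obtains a j where "i = a * n + j" "a < k" "j < n"
proof -
  have "n > 0" using assms by (cases n) auto
  then show ?thesis
    using assms that[of "i div n" "i mod n"] by (simp add: less_mult_imp_div_less)
qed

lemma block_eq_iff:
  "j < n \<Longrightarrow> j' < n \<Longrightarrow> a * n + j = a' * n + j' \<longleftrightarrow> a = a' \<and> j = (j'::nat)"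
  by (metis div_mult_self3 div_less add_0_right mod_mult_self3 mod_less not_less0)

text \<open>Values of \<open>f\<close> on \<open>{1..k}\<close> are positive, so the truncated
  subtraction in \<open>spread\<close> loses nothing.\<close>

lemma permutes_Suc_pred:
  assumes "f permutes {1..k}" "a < k"
  shows "f (Suc a) - 1 < k" "Suc (f (Suc a) - 1) = f (Suc a)"
proof -
  have "f (Suc a) \<in> {1..k}"
    using permutes_in_image[OF assms(1), of "Suc a"] assms(2) by simp
  then show "f (Suc a) - 1 < k" "Suc (f (Suc a) - 1) = f (Suc a)" by auto
qed

lemma spread_in_residue_perms:
  assumes "\<And>j. j < n \<Longrightarrow> f j permutes {1..k}"
  shows "spread k n f \<in> residue_perms k n"
  unfolding residue_perms_def mem_Collect_eq
proof
  show "spread k n f permutes {..<k * n}"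
  proof (rule permutes_if_inj)
    show "inj_on (spread k n f) {..<k * n}"
    proof (rule inj_onI)
      fix x y assume "x \<in> {..<k * n}" "y \<in> {..<k * n}" and eq: "spread k n f x = spread k n f y"
      then obtain a j b l where x: "x = a * n + j" "a < k" "j < n" and y: "y = b * n + l" "b < k" "l < n"
        by (metis block_cases lessThan_iff)
      have l: "l = j" and "f j (Suc a) - 1 = f j (Suc b) - 1"
        using eq x y by (auto simp: spread_block block_eq_iff)
      then have "f j (Suc a) = f j (Suc b)"
        using permutes_Suc_pred(2)[OF assms] x y by metis
      then have "a = b"
        using inj_eq[OF permutes_inj[OF assms[OF \<open>j < n\<close>]]] by simp
      then show "x = y" using x y l by simp
    qed
    show "spread k n f ` {..<k * n} \<subseteq> {..<k * n}"
      using permutes_Suc_pred(1)[OF assms] by (auto elim!: block_cases simp: spread_block block_less)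
  qed (auto simp: spread_def)
  show "covers n (k * n) (spread k n f) id"
    by (auto simp: covers_def spread_def)
qed

text \<open>When \<open>q\<close> fixes every residue, only block numbers change, and for each
  residue \<open>j\<close> their change is a permutation of the \<open>k\<close> blocks.\<close>

lemma spread_surj:
  assumes q: "q \<in> residue_perms k n"
  obtains f where "f \<in> (\<Pi>\<^sub>E j\<in>{..<n}. {p. p permutes {1..k}})" "spread k n f = q"
proof
  have perm: "q permutes {..<k * n}" and cov: "\<And>i. i < k * n \<Longrightarrow> q i mod n = i mod n"
    using q by (auto simp: residue_perms_def covers_def)
  define f where
    \<comment> \<open>The new block number is read off with block indices shifted by one. The two
      defaults are forced: \<open>undefined\<close> for \<open>j\<close> outside
      \<open>{..<n}\<close> by the extensional product, and the identity outside
      \<open>{1..k}\<close> by \<open>permutes\<close>.\<close>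
    "f = (\<lambda>j\<in>{..<n}. \<lambda>a. if a \<in> {1..k} then Suc (q ((a - 1) * n + j) div n) else a)"
  have q_block: "q (a * n + j) = (q (a * n + j) div n) * n + j" "q (a * n + j) div n < k"
    if "a < k" "j < n" for a j
  proof -
    have *: "a * n + j < k * n" by (rule block_less[OF that])
    then show "q (a * n + j) = (q (a * n + j) div n) * n + j"
      using cov[OF *] that by (metis div_mult_mod_eq mod_mult_self3 mod_less)
    show "q (a * n + j) div n < k"
      using * permutes_in_image[OF perm, of "a * n + j"] by (simp add: less_mult_imp_div_less)
  qed
  have "f j permutes {1..k}" if j: "j < n" for j
  proof (rule permutes_if_inj)
    show "inj_on (f j) {1..k}"
    proof (rule inj_onI)
      fix a b assume ab: "a \<in> {1..k}" "b \<in> {1..k}" "f j a = f j b"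
      then have "q ((a - 1) * n + j) div n = q ((b - 1) * n + j) div n"
        using j by (simp add: f_def)
      moreover have "a - 1 < k" "b - 1 < k"
        using ab by auto
      ultimately have "q ((a - 1) * n + j) = q ((b - 1) * n + j)"
        using q_block(1) j by metis
      then have "(a - 1) * n + j = (b - 1) * n + j"
        by (simp only: inj_eq[OF permutes_inj[OF perm]])
      then have "a - 1 = b - 1"
        using j block_eq_iff by blast
      then show "a = b" using ab by auto
    qed
    show "f j ` {1..k} \<subseteq> {1..k}"
      using q_block(2)[OF _ j] j by (auto simp: f_def Suc_le_eq)
  qed (use j in \<open>auto simp: f_def\<close>)
  then show "f \<in> (\<Pi>\<^sub>E j\<in>{..<n}. {p. p permutes {1..k}})"
    by (auto simp: PiE_iff f_def)
  show "spread k n f = q"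
  proof
    fix i show "spread k n f i = q i"
    proof (cases "i < k * n")
      case True
      then obtain a j where i: "i = a * n + j" "a < k" "j < n"
        by (rule block_cases)
      then show ?thesis
        using q_block(1)[of a j] by (simp add: spread_block) (simp add: f_def)
    next
      case False
      then show ?thesis
        using permutes_not_in[OF perm, of i] by (simp add: spread_def)
    qed
  qed
qed

lemma spread_inj:
  "inj_on (spread k n) (\<Pi>\<^sub>E j\<in>{..<n}. {p. p permutes {1..k}})"
proof (rule inj_onI)
  fix f h assume f: "f \<in> (\<Pi>\<^sub>E j\<in>{..<n}. {p. p permutes {1..k}})"
    and h: "h \<in> (\<Pi>\<^sub>E j\<in>{..<n}. {p. p permutes {1..k}})" and eq: "spread k n f = spread k n h"
  show "f = h"
  proof (rule PiE_ext[OF f h], rule ext)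
    fix j a assume "j \<in> {..<n}"
    then have j: "j < n" and fj: "f j permutes {1..k}" and hj: "h j permutes {1..k}"
      using f h by auto
    show "f j a = h j a"
    proof (cases "a \<in> {1..k}")
      case True
      then obtain b where b: "a = Suc b" "b < k"
        by (cases a) auto
      have "f j a - 1 = h j a - 1"
        using fun_cong[OF eq, of "b * n + j"] b j by (simp add: spread_block block_eq_iff)
      then show ?thesis
        using permutes_Suc_pred(2)[OF fj b(2)] permutes_Suc_pred(2)[OF hj b(2)] b by metis
    qed (simp add: permutes_not_in[OF fj] permutes_not_in[OF hj])
  qed
qed

lemma spread_comp:
  \<comment> \<open>Spreading \<open>h\<close> keeps the residue \<open>j\<close>, so the component
    of \<open>f\<close> applied next is again the one at \<open>j\<close>.\<close>
  assumes "f \<in> (\<Pi>\<^sub>E j\<in>{..<n}. {p. p permutes {1..k}})" "h \<in> (\<Pi>\<^sub>E j\<in>{..<n}. {p. p permutes {1..k}})"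
  shows "spread k n (\<lambda>j\<in>{..<n}. f j \<circ> h j) = spread k n f \<circ> spread k n h"
proof
  fix i
  show "spread k n (\<lambda>j\<in>{..<n}. f j \<circ> h j) i = (spread k n f \<circ> spread k n h) i"
  proof (cases "i < k * n")
    case True
    then obtain a j where i: "i = a * n + j" "a < k" "j < n"
      by (rule block_cases)
    then have "h j permutes {1..k}" using assms by auto
    with i show ?thesis
      using permutes_Suc_pred[of "h j" k a] by (simp add: spread_block)
  qed (simp add: spread_def)
qed

lemma residue_perms_iso_product:
  "\<lparr>carrier = residue_perms k n, monoid.mult = (\<circ>), one = id\<rparr> \<cong>
    product_group {..<n} (\<lambda>_. sym_group k)"
proof -
  let ?P = "product_group {..<n} (\<lambda>_. sym_group k)"
  let ?G = "\<lparr>carrier = residue_perms k n, monoid.mult = (\<circ>), one = id\<rparr>"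
  have P: "carrier ?P = (\<Pi>\<^sub>E j\<in>{..<n}. {p. p permutes {1..k}})"
    by (simp add: sym_group_def)
  have "spread k n ` carrier ?P = carrier ?G"
    unfolding P by (force elim: spread_surj intro: spread_in_residue_perms)
  then have "spread k n \<in> iso ?P ?G"
    using spread_inj[of k n] spread_comp
    by (intro isoI homI) (auto simp: P bij_betw_def sym_group_mult simp del: carrier_product_group)
  moreover have "group ?P"
    by (simp add: sym_group_is_group)
  ultimately show ?thesis
    using group.iso_sym is_isoI by blast
qed

section \<open>The split extension\<close>

text \<open>Only block 0 is inspected, which suffices when \<open>q\<close> covers some permutation.
  Fixing all \<open>j \<ge> n\<close> matches the convention of \<open>permutes\<close>.\<close>

definition induced :: "nat \<Rightarrow> (nat \<Rightarrow> nat) \<Rightarrow> nat \<Rightarrow> nat"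
  where "induced n q j = (if j < n then q j mod n else j)"

lemma induced_eq_if_covers:
  assumes "k > 0" "p permutes {..<n}" "covers n (k * n) q p"
  shows "induced n q = p"
proof
  fix j
  have "j < k * n" if "j < n"
    using block_less[of 0 k j n] that assms(1) by simp
  then show "induced n q j = p j"
    using assms permutes_not_in[OF assms(2), of j] by (auto simp: induced_def covers_def)
qed

text \<open>The standard embedding of the top group into a wreath product; it serves as the section
  of \<open>induced n\<close>.\<close>

definition block_lift :: "nat \<Rightarrow> nat \<Rightarrow> (nat \<Rightarrow> nat) \<Rightarrow> nat \<Rightarrow> nat"
  where "block_lift k n p i = (if i < k * n then (i div n) * n + p (i mod n) else i)"

lemma block_lift_block:
  "a < k \<Longrightarrow> j < n \<Longrightarrow> block_lift k n p (a * n + j) = a * n + p j"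
  using block_less[of a k j n] by (simp add: block_lift_def)

lemma block_lift:
  assumes p: "p permutes {..<n}"
  shows "block_lift k n p permutes {..<k * n}" "covers n (k * n) (block_lift k n p) p"
proof -
  have less: "p j < n" if "j < n" for j
    using permutes_in_image[OF p, of j] that by simp
  show "block_lift k n p permutes {..<k * n}"
  proof (rule permutes_if_inj)
    show "inj_on (block_lift k n p) {..<k * n}"
      by (auto intro!: inj_onI elim!: block_cases
          simp: block_lift_block block_eq_iff less inj_eq[OF permutes_inj[OF p]])
    show "block_lift k n p ` {..<k * n} \<subseteq> {..<k * n}"
      by (auto elim!: block_cases simp: block_lift_block block_less less)
  qed (auto simp: block_lift_def)
  show "covers n (k * n) (block_lift k n p) p"
    unfolding covers_def by (auto elim!: block_cases simp: block_lift_block less)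
qed

lemma block_lift_comp:
  assumes "p' permutes {..<n}"
  shows "block_lift k n (p \<circ> p') = block_lift k n p \<circ> block_lift k n p'"
proof
  fix i
  show "block_lift k n (p \<circ> p') i = (block_lift k n p \<circ> block_lift k n p') i"
  proof (cases "i < k * n")
    case True
    then obtain a j where i: "i = a * n + j" "a < k" "j < n"
      by (rule block_cases)
    then have "p' j < n"
      using permutes_in_image[OF assms, of j] by simp
    with i show ?thesis by (simp add: block_lift_block)
  qed (simp add: block_lift_def)
qed

theorem theorem3p3:
  fixes n k m :: nat and g :: "bit poly"
  assumes "n > 0" and "k > 0"
    and "Polynomial.degree g = m" and "m > 1"
    and "g dvd Polynomial.monom 1 n - 1"
  shows "\<exists>H. subgroup H (Aut_code (k * n) (cyclic_code (k * n) g)) \<and>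
    is_semidirect_product ((Aut_code (k * n) (cyclic_code (k * n) g))\<lparr>carrier := H\<rparr>)
      (product_group {..<n} (\<lambda>_. sym_group k))
      (Aut_code n (cyclic_code n g))"
proof (intro exI conjI)
  let ?A = "Aut_code (k * n) (cyclic_code (k * n) g)"
  let ?B = "Aut_code n (cyclic_code n g)"
  \<comment> \<open>The witness is the group of all permutations that induce some automorphism of
    the short code on residues.\<close>
  define H where "H = {q. q permutes {..<k * n} \<and> (\<exists>p\<in>carrier ?B. covers n (k * n) q p)}"
  let ?G = "?A\<lparr>carrier := H\<rparr>"
  have G: "?G = \<lparr>carrier = H, monoid.mult = (\<circ>), one = id\<rparr>"
    by (simp add: Aut_code_def)
  have B: "group ?B"
    by (rule group_Aut_code[OF cyclic_code_length])
  have B_perm: "p permutes {..<n}" if "p \<in> carrier ?B" for p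
    using that by (simp add: Aut_code_def code_automorphism_def)
  have B_mult: "p \<otimes>\<^bsub>?B\<^esub> p' = p \<circ> p'" and B_one: "\<one>\<^bsub>?B\<^esub> = id" for p p'
    by (simp_all add: Aut_code_def)
  have B_comp: "p \<circ> p' \<in> carrier ?B" if "p \<in> carrier ?B" "p' \<in> carrier ?B" for p p'
    using code_automorphism_comp[OF cyclic_code_length] that by (simp add: Aut_code_def)
  have B_inv: "inv_into UNIV p \<in> carrier ?B" if "p \<in> carrier ?B" for p
    using code_automorphism_inv[OF cyclic_code_length] that by (simp add: Aut_code_def)
  have id_B: "id \<in> carrier ?B"
    using group.is_monoid[OF B] monoid.one_closed[of ?B] by (simp add: B_one)
  \<comment> \<open>The covered automorphism is unique and equals \<open>induced n q\<close>, which
    turns the relation into a map from \<open>H\<close>.\<close>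
  have HE: "\<exists>p\<in>carrier ?B. covers n (k * n) q p \<and> induced n q = p" if "q \<in> H" for q
    using that induced_eq_if_covers[OF \<open>k > 0\<close>] B_perm unfolding H_def by blast
  have H_perm: "q permutes {..<k * n}" if "q \<in> H" for q
    using that by (simp add: H_def)
  have HI: "q \<in> H" if "q permutes {..<k * n}" "p \<in> carrier ?B" "covers n (k * n) q p" for q p
    using that by (auto simp: H_def)
  have id_H: "id \<in> H"
    by (rule HI[OF _ id_B]) (simp_all add: permutes_id)
  have comp: "q \<circ> q' \<in> H \<and> induced n (q \<circ> q') = induced n q \<circ> induced n q'"
    if "q \<in> H" "q' \<in> H" for q q'
  proof -
    from HE[OF that(1)] HE[OF that(2)] obtain p p' where
      p: "p \<in> carrier ?B" "covers n (k * n) q p" "induced n q = p" and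
      p': "p' \<in> carrier ?B" "covers n (k * n) q' p'" "induced n q' = p'"
      by blast
    have cov: "covers n (k * n) (q \<circ> q') (p \<circ> p')"
      by (rule covers_comp[OF H_perm[OF that(2)] p(2) p'(2)])
    have "q \<circ> q' \<in> H"
      using HI[OF _ B_comp[OF p(1) p'(1)] cov] H_perm that permutes_compose by blast
    then show ?thesis
      using induced_eq_if_covers[OF \<open>k > 0\<close> B_perm[OF B_comp[OF p(1) p'(1)]] cov] p p' by simp
  qed
  have inv: "inv_into UNIV q \<in> H" if "q \<in> H" for q
    using that HE[OF that] HI B_inv covers_inv B_perm H_perm permutes_inv by metis
  have grp: "group ?G"
    unfolding G by (rule permutes_group) (use H_perm id_H comp inv in auto)
  \<comment> \<open>The divisibility of x^n - 1 by \<open>g\<close> is used here, through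
    folding.\<close>
  have "H \<subseteq> carrier ?A"
    using code_automorphism_covers[OF \<open>n > 0\<close> assms(5)] by (auto simp: H_def Aut_code_def)
  then show "subgroup H ?A"
    using grp group.group_incl_imp_subgroup[OF group_Aut_code[OF cyclic_code_length]] by blast
  show "is_semidirect_product ?G (product_group {..<n} (\<lambda>_. sym_group k)) ?B"
  proof (rule is_semidirect_product_if_split[OF grp B])
    show "induced n \<in> hom ?G ?B"
      using HE comp by (auto simp: G B_mult intro!: homI)
    have lift: "block_lift k n p \<in> H" if "p \<in> carrier ?B" for p
      using HI[OF _ that] block_lift[OF B_perm[OF that]] by blast
    show "block_lift k n \<in> hom ?B ?G"
      using lift block_lift_comp B_perm by (auto simp: G B_mult intro!: homI)
    show "induced n (block_lift k n p) = p" if "p \<in> carrier ?B" for p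
      using induced_eq_if_covers[OF \<open>k > 0\<close>] block_lift B_perm[OF that] by blast
    \<comment> \<open>Inducing the identity means covering \<open>id\<close>, that is, preserving
      every residue class.\<close>
    have "kernel ?G ?B (induced n) = residue_perms k n"
    proof (intro equalityI subsetI)
      fix q assume "q \<in> kernel ?G ?B (induced n)"
      then have "q \<in> H" "induced n q = id"
        by (auto simp: kernel_def B_one)
      then show "q \<in> residue_perms k n"
        using HE[of q] H_perm by (auto simp: residue_perms_def)
    next
      fix q assume "q \<in> residue_perms k n"
      then have q: "q permutes {..<k * n}" "covers n (k * n) q id"
        by (auto simp: residue_perms_def)
      then show "q \<in> kernel ?G ?B (induced n)"
        using HI[OF q(1) id_B q(2)] induced_eq_if_covers[OF \<open>k > 0\<close> permutes_id q(2)]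
        by (simp add: kernel_def B_one)
    qed
    then show "?G\<lparr>carrier := kernel ?G ?B (induced n)\<rparr> \<cong> product_group {..<n} (\<lambda>_. sym_group k)"
      using residue_perms_iso_product[of k n] by (simp add: Aut_code_def)
  qed
qed

end
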